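(* If $\rho$ is a real number in $(0,1]$ and $T$ is a tree of order $n(T)$ at least $\frac{1}{\rho}$, then $$h_{\phi_{\rho}}(T)\leq \rho\, n(T).$$
   Context: All graphs are finite, simple, and undirected. For a graph $G$, $V(G)$ is its vertex set, $n(G)=|V(G)|$ is its order, and $d_G(u)$ is the degree of a vertex $u$ in $G$. For a threshold function $\phi:V(G)\to\mathbb{N}_0$ with $\phi(u)\leq d_G(u)$ for every $u\in V(G)$, and a set $D\subseteq V(G)$, let $H_{(G,\phi)}(D)$ be the smallest set $\bar D\subseteq V(G)$ such that $D\subseteq\bar D$ and every vertex $u\in V(G)\setminus\bar D$ has fewer than $\phi(u)$ neighbors in $\bar D$. (Equivalently, $H_{(G,\phi)}(D)$ arises by starting with $D$ and iteratively adding vertices $u$ that have at least $\phi(u)$ neighbors in the current set.) The set $D$ is a $\phi$-dynamic monopoly of $G$ if $H_{(G,\phi)}(D)=V(G)$, and $h_{\phi}(G)$ denotes the minimum cardinality of a $\phi$-dynamic monopoly of $G$. For a real $\rho\in[0,1]$, the degree proportional threshold function is $\phi_{\rho}:V(G)\to\mathbb{N}_0$, $\phi_{\rho}(u)=\lceil\rho\, d_G(u)\rceil$. *)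

theory Defs
  imports Complex_Main "Graph_Theory.Graph_Theory"
begin

text \<open>
  A finite simple undirected graph is a \<^locale>\<open>pair_graph\<close>: finitely many vertices and a symmetric
  irreflexive set of arcs, each undirected edge being present as two opposite arcs.
\<close>

definition neighbors :: "'a pair_pre_digraph \<Rightarrow> 'a \<Rightarrow> 'a set" where
  "neighbors G u = {v. (u, v) \<in> parcs G}"

text \<open>
  In a symmetric digraph the walk \<open>a, b, a\<close> counts as a cycle, so \<^const>\<open>Digraph_Component.tree\<close>
  fails for every undirected tree with an edge. Cycles of undirected graphs have length at least
  three. The qualified \<open>connected\<close> is the graph-theoretic one; it excludes the null graph.
\<close>

definition undirected_tree :: "'a pair_pre_digraph \<Rightarrow> bool" where
  "undirected_tree T \<longleftrightarrow> pair_graph T \<and> Digraph_Component.connected (with_proj T) \<and>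
     \<not> (\<exists>p. pre_digraph.cycle (with_proj T) p \<and> 3 \<le> length p)"

abbreviation order :: "'a pair_pre_digraph \<Rightarrow> nat" where
  "order G \<equiv> card (pverts G)"

text \<open>By symmetry of the arc set, the degree of a vertex is its out-degree.\<close>

abbreviation degree :: "'a pair_pre_digraph \<Rightarrow> 'a \<Rightarrow> nat" where
  "degree G u \<equiv> out_degree (with_proj G) u"

lemma degree_eq_card_neighbors: "degree G u = card (neighbors G u)"
proof -
  have "out_arcs (with_proj G) u = Pair u ` neighbors G u"
    by (auto simp: out_arcs_def neighbors_def)
  then show ?thesis
    by (simp add: out_degree_def card_image inj_on_def)
qed

definition threshold_function :: "'a pair_pre_digraph \<Rightarrow> ('a \<Rightarrow> nat) \<Rightarrow> bool" where
  "threshold_function G \<phi> \<longleftrightarrow> (\<forall>u\<in>pverts G. \<phi> u \<le> degree G u)"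

definition phi_closed :: "'a pair_pre_digraph \<Rightarrow> ('a \<Rightarrow> nat) \<Rightarrow> 'a set \<Rightarrow> bool" where
  "phi_closed G \<phi> S \<longleftrightarrow>
     S \<subseteq> pverts G \<and> (\<forall>u \<in> pverts G - S. card (neighbors G u \<inter> S) < \<phi> u)"

text \<open>The least element is taken with respect to inclusion.\<close>

definition dyn_hull :: "'a pair_pre_digraph \<Rightarrow> ('a \<Rightarrow> nat) \<Rightarrow> 'a set \<Rightarrow> 'a set" where
  "dyn_hull G \<phi> D = (LEAST S. D \<subseteq> S \<and> phi_closed G \<phi> S)"

definition dynamic_monopoly :: "'a pair_pre_digraph \<Rightarrow> ('a \<Rightarrow> nat) \<Rightarrow> 'a set \<Rightarrow> bool" where
  "dynamic_monopoly G \<phi> D \<longleftrightarrow> D \<subseteq> pverts G \<and> dyn_hull G \<phi> D = pverts G"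

definition min_dynamic_monopoly :: "'a pair_pre_digraph \<Rightarrow> ('a \<Rightarrow> nat) \<Rightarrow> nat" where
  "min_dynamic_monopoly G \<phi> = (LEAST k. \<exists>D. dynamic_monopoly G \<phi> D \<and> card D = k)"

definition degree_proportional :: "real \<Rightarrow> 'a pair_pre_digraph \<Rightarrow> 'a \<Rightarrow> nat" where
  "degree_proportional \<rho> G u = nat \<lceil>\<rho> * real (degree G u)\<rceil>"

lemma threshold_function_degree_proportional:
  assumes "0 \<le> \<rho>" "\<rho> \<le> 1"
  shows "threshold_function G (degree_proportional \<rho> G)"
proof -
  have "\<rho> * real (degree G u) \<le> real (degree G u)" for u
    using assms by (simp add: mult_left_le_one_le)
  then have "\<lceil>\<rho> * real (degree G u)\<rceil> \<le> int (degree G u)" for u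
    by (simp add: ceiling_le_iff)
  then show ?thesis
    unfolding threshold_function_def degree_proportional_def by (simp add: nat_le_iff)
qed

text \<open>The least elements in \<^const>\<open>dyn_hull\<close> and \<^const>\<open>min_dynamic_monopoly\<close> exist.\<close>

lemma dyn_hull_is_least:
  assumes "pair_graph G" "D \<subseteq> pverts G"
  shows "D \<subseteq> dyn_hull G \<phi> D" "phi_closed G \<phi> (dyn_hull G \<phi> D)"
    "\<And>S. D \<subseteq> S \<Longrightarrow> phi_closed G \<phi> S \<Longrightarrow> dyn_hull G \<phi> D \<subseteq> S"
proof -
  interpret pair_graph G by fact
  have fin: "finite (neighbors G u)" for u
  proof (rule finite_subset)
    show "neighbors G u \<subseteq> snd ` parcs G" by (force simp: neighbors_def)
  qed (simp add: pair_finite_arcs)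
  define F where "F = {S. D \<subseteq> S \<and> phi_closed G \<phi> S}"
  have "pverts G \<in> F" using assms(2) by (simp add: F_def phi_closed_def)
  have "phi_closed G \<phi> (\<Inter>F)"
    unfolding phi_closed_def
  proof (intro conjI ballI)
    show "\<Inter>F \<subseteq> pverts G" using \<open>pverts G \<in> F\<close> by blast
    fix u assume u: "u \<in> pverts G - \<Inter>F"
    then obtain S where S: "S \<in> F" "u \<notin> S" by blast
    have "card (neighbors G u \<inter> \<Inter>F) \<le> card (neighbors G u \<inter> S)"
      using S fin by (intro card_mono) auto
    also have "\<dots> < \<phi> u" using S u by (auto simp: F_def phi_closed_def)
    finally show "card (neighbors G u \<inter> \<Inter>F) < \<phi> u" .
  qed
  then have least: "D \<subseteq> \<Inter>F \<and> phi_closed G \<phi> (\<Inter>F)" by (auto simp: F_def)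
  have "dyn_hull G \<phi> D = \<Inter>F"
    unfolding dyn_hull_def by (rule Least_equality) (use least in \<open>auto simp: F_def\<close>)
  then show "D \<subseteq> dyn_hull G \<phi> D" "phi_closed G \<phi> (dyn_hull G \<phi> D)"
    "\<And>S. D \<subseteq> S \<Longrightarrow> phi_closed G \<phi> S \<Longrightarrow> dyn_hull G \<phi> D \<subseteq> S"
    using least by (auto simp: F_def)
qed

lemma min_dynamic_monopoly_attained:
  assumes "pair_graph G"
  shows "\<exists>D. dynamic_monopoly G \<phi> D \<and> card D = min_dynamic_monopoly G \<phi>"
  unfolding min_dynamic_monopoly_def
proof (rule LeastI_ex)
  have "dyn_hull G \<phi> (pverts G) = pverts G"
    using dyn_hull_is_least[OF assms order_refl, where \<phi>=\<phi>] by (auto simp: phi_closed_def)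
  then show "\<exists>k D. dynamic_monopoly G \<phi> D \<and> card D = k"
    by (auto simp: dynamic_monopoly_def)
qed

end

theory Submission
  imports Defs
begin

text \<open>
  Root the tree and choose the seed set \<open>D\<close> greedily from the leaves upwards. Call a vertex
  autonomous if it becomes active without the help of its parent, and let \<open>a(v)\<close> be the number of
  autonomous children of \<open>v\<close>. If \<open>a(v) \<ge> \<phi>(v)\<close>, the children of \<open>v\<close> activate it; if
  \<open>a(v) = \<phi>(v) - 1\<close>, it suffices to wait for the parent, and \<open>v\<close> is not autonomous; otherwise \<open>v\<close> is
  beyond help and becomes a seed. The root, which has no parent to wait for, is a seed if
  \<open>a(v) < \<phi>(v)\<close>. So \<open>v\<close> is autonomous exactly if \<open>a(v) + 1 \<noteq> \<phi>(v)\<close>, and activity spreads first upwards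
  through the autonomous vertices and then downwards from the root (\<open>dynamic_monopoly_seeds\<close>).

  For the bound, every seed \<open>v\<close> is given the block of vertices that are reached from \<open>v\<close> by
  descending through vertices that are not autonomous. Blocks of distinct seeds are disjoint
  (\<open>block_disjoint\<close>), so it is enough that each of them has at least \<open>1/\<rho>\<close> vertices
  (\<open>block_size\<close>). A seed \<open>v\<close> other than the root has \<open>a(v) + 1 < \<phi>(v)\<close>, that is,
  \<open>a(v) + 1 < \<rho> d(v)\<close>. So only a fraction less than \<open>\<rho>\<close> of its neighbors consists of its parent
  and its autonomous children. As this part has at least one element, the remaining neighbors are
  more than \<open>1/\<rho> - 1\<close> in number, and they lie in the block. The same count works at the root unless
  \<open>a\<close> vanishes there. In that case, either some other vertex of the block of the root has an
  autonomous child, and the count for that vertex is good enough, or no vertex of the block has one.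
  Then the block is the whole tree, which has at least \<open>1/\<rho>\<close> vertices by assumption.
\<close>

section \<open>Rooted graphs\<close>

text \<open>
  The tree structure enters only in this form: every edge joins a vertex to its parent. The function
  \<open>depth\<close> makes the parent relation well-founded; the parent of the root is a junk value.
\<close>

locale rooted_graph = pair_graph G for G :: "'a pair_pre_digraph" +
  fixes root :: 'a and parent :: "'a \<Rightarrow> 'a" and depth :: "'a \<Rightarrow> nat"
  assumes root_in_verts: "root \<in> pverts G"
    and arc_parent: "\<And>v. v \<in> pverts G \<Longrightarrow> v \<noteq> root \<Longrightarrow> (v, parent v) \<in> parcs G"
    and depth_parent: "\<And>v. v \<in> pverts G \<Longrightarrow> v \<noteq> root \<Longrightarrow> depth (parent v) < depth v"
    and arc_cases: "\<And>u v. (u, v) \<in> parcs G \<Longrightarrow>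
      (u \<noteq> root \<and> v = parent u) \<or> (v \<noteq> root \<and> u = parent v)"
begin

definition children :: "'a \<Rightarrow> 'a set" where
  "children v = {u \<in> pverts G. u \<noteq> root \<and> parent u = v}"

lemma finite_children: "finite (children v)"
  using pair_finite_verts by (simp add: children_def)

lemma neighbors_eq:
  assumes "v \<in> pverts G"
  shows "neighbors G v = children v \<union> (if v = root then {} else {parent v})"
proof -
  have "(v, u) \<in> parcs G \<longleftrightarrow> u \<in> children v \<or> (v \<noteq> root \<and> u = parent v)" for u
  proof
    assume "(v, u) \<in> parcs G"
    then show "u \<in> children v \<or> (v \<noteq> root \<and> u = parent v)"
      using arc_cases[of v u] in_arcsD2[of v u] by (auto simp: children_def)
  next
    assume "u \<in> children v \<or> (v \<noteq> root \<and> u = parent v)"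
    then show "(v, u) \<in> parcs G"
      using arc_parent[of u] arc_parent[of v] arcs_symmetric[of u v] assms
      by (auto simp: children_def)
  qed
  then show ?thesis by (auto simp: neighbors_def)
qed

lemma parent_notin_children:
  assumes "v \<in> pverts G" "v \<noteq> root"
  shows "parent v \<notin> children v"
  using depth_parent[OF assms] depth_parent[of "parent v"] by (auto simp: children_def)

lemma parent_in_verts: "v \<in> pverts G \<Longrightarrow> v \<noteq> root \<Longrightarrow> parent v \<in> pverts G"
  using arc_parent in_arcsD2 by blast

lemma wf_children: "wf {(u, v). u \<in> children v}"
proof (rule wf_subset)
  define N where "N = Max (depth ` pverts G)"
  define f where "f v = (if v \<in> pverts G then Suc N - depth v else Suc (Suc N))" for v
  show "wf (measure f)" by simp
  show "{(u, v). u \<in> children v} \<subseteq> measure f"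
  proof clarify
    fix u v assume "u \<in> children v"
    then have "u \<in> pverts G" "depth v < depth u" "v \<in> pverts G"
      using depth_parent[of u] parent_in_verts[of u] by (auto simp: children_def)
    moreover from this have "depth u \<le> N" using pair_finite_verts by (simp add: N_def)
    ultimately show "(u, v) \<in> measure f" by (simp add: f_def)
  qed
qed

section \<open>The greedy seed set\<close>

text \<open>
  The recursion goes from the leaves to the root. A vertex is not autonomous exactly if it lacks
  one active neighbor after its children have done what they can; with a larger deficit it is
  made a seed.
\<close>

definition autonomous :: "('a \<Rightarrow> nat) \<Rightarrow> 'a \<Rightarrow> bool" where
  "autonomous \<phi> = wfrec {(u, v). u \<in> children v}
     (\<lambda>f v. Suc (card {u \<in> children v. f u}) \<noteq> \<phi> v)"

definition autonomous_children :: "('a \<Rightarrow> nat) \<Rightarrow> 'a \<Rightarrow> 'a set" where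
  "autonomous_children \<phi> v = {u \<in> children v. autonomous \<phi> u}"

definition dependent_children :: "('a \<Rightarrow> nat) \<Rightarrow> 'a \<Rightarrow> 'a set" where
  "dependent_children \<phi> v = {u \<in> children v. \<not> autonomous \<phi> u}"

definition seeds :: "('a \<Rightarrow> nat) \<Rightarrow> 'a set" where
  "seeds \<phi> = {v \<in> pverts G. card (autonomous_children \<phi> v) + of_bool (v \<noteq> root) < \<phi> v}"

lemma autonomous_iff: "autonomous \<phi> v \<longleftrightarrow> Suc (card (autonomous_children \<phi> v)) \<noteq> \<phi> v"
proof -
  have "{u \<in> children v. cut (autonomous \<phi>) {(u, v). u \<in> children v} v u}
      = autonomous_children \<phi> v"
    by (auto simp: autonomous_children_def cut_def)
  then show ?thesis
    using wfrec[OF wf_children, of "\<lambda>f v. Suc (card {u \<in> children v. f u}) \<noteq> \<phi> v" v,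
        folded autonomous_def] by simp
qed

lemma finite_autonomous_children: "finite (autonomous_children \<phi> v)"
  using finite_children by (simp add: autonomous_children_def)

lemma finite_dependent_children: "finite (dependent_children \<phi> v)"
  using finite_children by (simp add: dependent_children_def)

lemma card_neighbors:
  assumes "v \<in> pverts G"
  shows "card (neighbors G v)
    = card (autonomous_children \<phi> v) + card (dependent_children \<phi> v) + of_bool (v \<noteq> root)"
proof -
  have "children v = autonomous_children \<phi> v \<union> dependent_children \<phi> v"
    by (auto simp: autonomous_children_def dependent_children_def)
  moreover have "autonomous_children \<phi> v \<inter> dependent_children \<phi> v = {}"
    by (auto simp: autonomous_children_def dependent_children_def)
  ultimately have "card (children v)
      = card (autonomous_children \<phi> v) + card (dependent_children \<phi> v)"
    by (simp add: card_Un_disjoint finite_autonomous_children finite_dependent_children)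
  then show ?thesis
    using parent_notin_children[OF assms] finite_children
    by (auto simp: neighbors_eq[OF assms])
qed

lemma finite_neighbors: "v \<in> pverts G \<Longrightarrow> finite (neighbors G v)"
  by (simp add: neighbors_eq finite_children)

text \<open>
  The vertices enter the hull in two sweeps: the autonomous ones from the leaves upwards (\<open>up\<close>),
  then the others from the root downwards, each as soon as its parent has entered.
\<close>

lemma dynamic_monopoly_seeds: "dynamic_monopoly G \<phi> (seeds \<phi>)"
proof -
  define X where "X = dyn_hull G \<phi> (seeds \<phi>)"
  have "seeds \<phi> \<subseteq> pverts G" by (auto simp: seeds_def)
  note hull = dyn_hull_is_least[OF pair_graph this, where \<phi> = \<phi>]
  have seeds: "seeds \<phi> \<subseteq> X" and closed: "phi_closed G \<phi> X"
    using hull by (auto simp: X_def)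
  have activate: "v \<in> X"
    if "v \<in> pverts G" "A \<subseteq> neighbors G v" "A \<subseteq> X" "\<phi> v \<le> card A" for v A
  proof (rule ccontr)
    assume "v \<notin> X"
    then have "card (neighbors G v \<inter> X) < \<phi> v"
      using closed that by (auto simp: phi_closed_def)
    moreover have "card A \<le> card (neighbors G v \<inter> X)"
      using that by (intro card_mono) (auto intro: finite_neighbors)
    ultimately show False using that by simp
  qed
  have sub: "autonomous_children \<phi> v \<subseteq> neighbors G v" if "v \<in> pverts G" for v
    by (auto simp: neighbors_eq[OF that] autonomous_children_def)
  have up: "v \<in> pverts G \<longrightarrow> autonomous \<phi> v \<longrightarrow> v \<in> X" for v
  proof (induction v rule: wf_induct_rule[OF wf_children])
    case (1 v)
    show ?case
    proof (intro impI)
      assume v: "v \<in> pverts G" "autonomous \<phi> v"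
      have X: "autonomous_children \<phi> v \<subseteq> X"
        using 1 by (auto simp: autonomous_children_def children_def)
      show "v \<in> X"
      proof (cases "\<phi> v \<le> card (autonomous_children \<phi> v)")
        case True
        then show ?thesis using activate[OF v(1) sub[OF v(1)] X] by simp
      next
        case False
        then have "v \<in> seeds \<phi>" using v autonomous_iff[of \<phi> v] by (auto simp: seeds_def)
        then show ?thesis using seeds by blast
      qed
    qed
  qed
  then have X: "autonomous_children \<phi> v \<subseteq> X" for v
    by (auto simp: autonomous_children_def children_def)
  have "v \<in> pverts G \<longrightarrow> v \<in> X" for v
  proof (induction v rule: measure_induct_rule[of depth])
    case (less v)
    show ?case
    proof
      assume v: "v \<in> pverts G"
      show "v \<in> X"
      proof (cases "v = root")
        case True
        show ?thesis
        proof (cases "\<phi> v \<le> card (autonomous_children \<phi> v)")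
          case True
          then show ?thesis using activate[OF v sub[OF v] X] by simp
        next
          case False
          with \<open>v = root\<close> v have "v \<in> seeds \<phi>" by (auto simp: seeds_def)
          then show ?thesis using seeds by blast
        qed
      next
        case False
        show ?thesis
        proof (cases "autonomous \<phi> v")
          case True
          then show ?thesis using up v by blast
        next
          case dependent: False
          let ?A = "insert (parent v) (autonomous_children \<phi> v)"
          have "parent v \<notin> autonomous_children \<phi> v"
            using parent_notin_children[OF v False] by (auto simp: autonomous_children_def)
          then have "card ?A = \<phi> v"
            using dependent autonomous_iff[of \<phi> v] by (simp add: finite_autonomous_children)
          moreover have "parent v \<in> X"
            using less depth_parent[OF v False] parent_in_verts[OF v False] by blast
          moreover have "?A \<subseteq> neighbors G v"
            using sub[OF v] False by (auto simp: neighbors_eq[OF v])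
          ultimately show ?thesis using activate[OF v, of ?A] X by auto
        qed
      qed
    qed
  qed
  then have "X = pverts G" using closed by (auto simp: phi_closed_def)
  then show ?thesis using \<open>seeds \<phi> \<subseteq> pverts G\<close> by (simp add: dynamic_monopoly_def X_def)
qed

section \<open>Blocks of seeds\<close>

definition block :: "('a \<Rightarrow> nat) \<Rightarrow> 'a \<Rightarrow> 'a set" where
  "block \<phi> v = {x. (x, v) \<in> {(u, w). u \<in> dependent_children \<phi> w}\<^sup>*}"

lemma block_self: "v \<in> block \<phi> v"
  by (simp add: block_def)

lemma block_dependent_children: "x \<in> block \<phi> v \<Longrightarrow> dependent_children \<phi> x \<subseteq> block \<phi> v"
  by (auto simp: block_def intro: converse_rtrancl_into_rtrancl)

lemma block_cases:
  assumes "x \<in> block \<phi> v"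
  shows "x = v \<or> x \<in> pverts G \<and> x \<noteq> root \<and> \<not> autonomous \<phi> x"
proof -
  have "(x, v) \<in> {(u, w). u \<in> dependent_children \<phi> w}\<^sup>*"
    using assms by (simp add: block_def)
  then show ?thesis
    by (cases rule: converse_rtranclE) (auto simp: dependent_children_def children_def)
qed

lemma block_subset_verts: "v \<in> pverts G \<Longrightarrow> block \<phi> v \<subseteq> pverts G"
  using block_cases by blast

lemma seed_autonomous: "v \<in> seeds \<phi> \<Longrightarrow> v \<noteq> root \<Longrightarrow> autonomous \<phi> v"
  by (auto simp: seeds_def autonomous_iff)

text \<open>
  The ways up from a common vertex of two blocks are nested, so one of the two seeds would lie in
  the block of the other. But a seed is the root or autonomous, and a block contains no such vertex
  besides its own seed.
\<close>

lemma block_disjoint: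
  assumes "v \<in> seeds \<phi>" "w \<in> seeds \<phi>" "v \<noteq> w"
  shows "block \<phi> v \<inter> block \<phi> w = {}"
proof (rule ccontr)
  let ?Q = "{(u, w). u \<in> dependent_children \<phi> w}"
  assume "block \<phi> v \<inter> block \<phi> w \<noteq> {}"
  then obtain x where "(x, v) \<in> ?Q\<^sup>*" "(x, w) \<in> ?Q\<^sup>*" by (auto simp: block_def)
  moreover have "single_valued ?Q"
    by (auto simp: single_valued_def dependent_children_def children_def)
  ultimately have "(v, w) \<in> ?Q\<^sup>* \<or> (w, v) \<in> ?Q\<^sup>*"
    by (rule single_valued_confluent[rotated])
  then have "v \<in> block \<phi> w \<or> w \<in> block \<phi> v" by (simp add: block_def)
  then show False
    using block_cases[of v \<phi> w] block_cases[of w \<phi> v] seed_autonomous[of v \<phi>]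
      seed_autonomous[of w \<phi>] assms by blast
qed

end

text \<open>
  If a nonempty part of \<open>k\<close> out of \<open>k + h\<close> neighbors has proportion less than \<open>\<rho>\<close>, then \<open>h\<close> exceeds
  \<open>1/\<rho> - 1\<close>: removing all but one element of the part lowers \<open>k\<close> by \<open>k - 1\<close> and \<open>\<rho> (k + h)\<close> by no
  more than that, which leaves \<open>1 < \<rho> (1 + h)\<close>.
\<close>

lemma proportion_bound:
  fixes \<rho> k h :: real
  assumes "\<rho> \<le> 1" "1 \<le> k" "k < \<rho> * (k + h)"
  shows "1 < \<rho> * (1 + h)"
proof -
  have "\<rho> * (k - 1) \<le> 1 * (k - 1)" using assms by (intro mult_right_mono) auto
  then show ?thesis using assms(3) by (simp add: algebra_simps)
qed

context rooted_graph
begin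

text \<open>
  The assumption on \<open>\<phi>\<close> says that \<open>\<phi>(v) \<le> \<lceil>\<rho> d(v)\<rceil>\<close>. The number \<open>a\<close> below counts the parent of \<open>v\<close>, if any,
  with the autonomous children, so it vanishes only at the root. There the count is carried out
  at a vertex \<open>x\<close> of the block that has \<open>b \<ge> 1\<close> autonomous children: as \<open>\<phi>(x) = b + 1\<close>, also
  \<open>b < \<rho> d(x)\<close>. If there is no such \<open>x\<close>, the block is closed under children and exhausts the graph.
\<close>

lemma block_size:
  fixes \<rho> :: real
  assumes \<rho>: "0 < \<rho>" "\<rho> \<le> 1"
    and \<phi>: "\<And>v k. v \<in> pverts G \<Longrightarrow> k < \<phi> v \<Longrightarrow> real k < \<rho> * real (card (neighbors G v))"
    and order: "1 \<le> \<rho> * real (order G)"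
    and v: "v \<in> seeds \<phi>"
  shows "1 \<le> \<rho> * real (card (block \<phi> v))"
proof -
  have vV: "v \<in> pverts G" using v by (simp add: seeds_def)
  have fin: "finite (block \<phi> v)"
    using block_subset_verts[OF vV] pair_finite_verts finite_subset by blast
  define a where "a = card (autonomous_children \<phi> v) + of_bool (v \<noteq> root)"
  show ?thesis
  proof (cases "a = 0")
    case False
    have "real a < \<rho> * (real a + real (card (dependent_children \<phi> v)))"
      using \<phi>[OF vV, of a] v card_neighbors[OF vV, of \<phi>]
      by (simp add: seeds_def a_def algebra_simps)
    then have "1 < \<rho> * (1 + real (card (dependent_children \<phi> v)))"
      using False \<rho> by (intro proportion_bound[of \<rho> "real a"]) auto
    also have "\<dots> = \<rho> * real (card (insert v (dependent_children \<phi> v)))"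
      using wf_children[THEN wf_not_refl, of v] finite_dependent_children
      by (simp add: dependent_children_def)
    also have "\<dots> \<le> \<rho> * real (card (block \<phi> v))"
      using \<rho> block_self block_dependent_children[OF block_self] fin
      by (intro mult_left_mono of_nat_mono card_mono) auto
    finally show ?thesis by simp
  next
    case True
    then have root: "v = root" and none: "autonomous_children \<phi> v = {}"
      using finite_autonomous_children by (auto simp: a_def split: if_splits)
    show ?thesis
    proof (cases "\<exists>x \<in> block \<phi> v. autonomous_children \<phi> x \<noteq> {}")
      case True
      then obtain x where x: "x \<in> block \<phi> v" "autonomous_children \<phi> x \<noteq> {}" by blast
      then have x': "x \<noteq> root" "x \<in> pverts G" "\<not> autonomous \<phi> x"
        using block_cases[OF x(1)] none root by auto
      define b where "b = card (autonomous_children \<phi> x)"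
      have "b < \<phi> x" using x' autonomous_iff[of \<phi> x] by (simp add: b_def)
      then have "real b < \<rho> * (real b + (real (card (dependent_children \<phi> x)) + 1))"
        using \<phi>[OF x'(2), of b] card_neighbors[OF x'(2), of \<phi>] x'
        by (simp add: b_def algebra_simps)
      moreover have "1 \<le> b"
        using x(2) finite_autonomous_children by (simp add: b_def Suc_le_eq card_gt_0_iff)
      ultimately have "1 < \<rho> * (1 + (real (card (dependent_children \<phi> x)) + 1))"
        using \<rho> by (intro proportion_bound[of \<rho> "real b"]) auto
      \<comment> \<open>The parent of \<open>x\<close> is counted with its dependent children; the root stands in for it.\<close>
      also have "\<dots> = \<rho> * real (card (insert root (insert x (dependent_children \<phi> x))))"
        using wf_children[THEN wf_not_refl, of x] finite_dependent_children x'
        by (simp add: dependent_children_def children_def)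
      also have "\<dots> \<le> \<rho> * real (card (block \<phi> v))"
        using \<rho> block_self[of v] block_dependent_children[OF x(1)] fin x root
        by (intro mult_left_mono of_nat_mono card_mono) auto
      finally show ?thesis by simp
    next
      case False
      have "u \<in> pverts G \<longrightarrow> u \<in> block \<phi> v" for u
      proof (induction u rule: measure_induct_rule[of depth])
        case (less u)
        show ?case
        proof
          assume u: "u \<in> pverts G"
          show "u \<in> block \<phi> v"
          proof (cases "u = root")
            case True
            then show ?thesis using block_self root by simp
          next
            case nonroot: False
            have p: "parent u \<in> block \<phi> v"
              using less depth_parent[OF u nonroot] parent_in_verts[OF u nonroot] by blast
            then have "autonomous_children \<phi> (parent u) = {}" using False by blast
            then have "u \<in> dependent_children \<phi> (parent u)"
              using u nonroot
              by (auto simp: autonomous_children_def dependent_children_def children_def)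
            then show ?thesis using block_dependent_children[OF p] by blast
          qed
        qed
      qed
      then have "block \<phi> v = pverts G" using block_subset_verts[OF vV] by blast
      then show ?thesis using order by simp
    qed
  qed
qed

lemma card_seeds_le:
  fixes \<rho> :: real
  assumes "0 < \<rho>" "\<rho> \<le> 1"
    and "\<And>v k. v \<in> pverts G \<Longrightarrow> k < \<phi> v \<Longrightarrow> real k < \<rho> * real (card (neighbors G v))"
    and "1 \<le> \<rho> * real (order G)"
  shows "real (card (seeds \<phi>)) \<le> \<rho> * real (order G)"
proof -
  have sub: "seeds \<phi> \<subseteq> pverts G" by (auto simp: seeds_def)
  then have fin: "finite (seeds \<phi>)" using pair_finite_verts finite_subset by blast
  have blocks: "block \<phi> v \<subseteq> pverts G" if "v \<in> seeds \<phi>" for v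
    using block_subset_verts sub that by blast
  have "real (card (seeds \<phi>)) = (\<Sum>v\<in>seeds \<phi>. 1)" by simp
  also have "\<dots> \<le> (\<Sum>v\<in>seeds \<phi>. \<rho> * real (card (block \<phi> v)))"
    using block_size[OF assms] by (intro sum_mono) auto
  also have "\<dots> = \<rho> * real (\<Sum>v\<in>seeds \<phi>. card (block \<phi> v))"
    by (simp add: sum_distrib_left)
  also have "(\<Sum>v\<in>seeds \<phi>. card (block \<phi> v)) = card (\<Union>v\<in>seeds \<phi>. block \<phi> v)"
    using fin block_disjoint finite_subset[OF blocks pair_finite_verts]
    by (intro card_UN_disjoint[symmetric]) auto
  also have "\<rho> * real (card (\<Union>v\<in>seeds \<phi>. block \<phi> v)) \<le> \<rho> * real (order G)"
    using assms(1) blocks pair_finite_verts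
    by (intro mult_left_mono of_nat_mono card_mono) auto
  finally show ?thesis .
qed

end

section \<open>Rooting a tree\<close>

text \<open>
  A path between two neighbors of \<open>v\<close> that avoids \<open>v\<close> closes up, through \<open>v\<close>, to a cycle; it has
  length at least three as the neighbors are distinct.
\<close>

lemma tree_neighbors_separated:
  assumes T: "undirected_tree T"
    and arcs: "(v, u) \<in> parcs T" "(v, w) \<in> parcs T"
    and reach: "(u, w) \<in> (parcs T \<inter> (- {v}) \<times> (- {v}))\<^sup>*"
  shows "u = w"
proof (rule ccontr)
  assume "u \<noteq> w"
  interpret pair_graph T using T by (simp add: undirected_tree_def)
  let ?E = "parcs T \<inter> (- {v}) \<times> (- {v})"
  have uw: "u \<in> pverts T" "u \<noteq> v" "(w, v) \<in> parcs T" "v \<in> pverts T"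
    using arcs in_arcsD1 in_arcsD2 no_loops' arcs_symmetric by blast+
  from reach have "\<exists>p. awalk u p w \<and> set p \<subseteq> ?E"
  proof induction
    case base
    have "awalk u [] u" using uw by (simp add: awalk_Nil_iff)
    then show ?case by (intro exI[of _ "[]"]) simp
  next
    case (step x y)
    then obtain p where p: "awalk u p x" "set p \<subseteq> ?E" by blast
    have "awalk x [(x, y)] y"
      using step.hyps(2) in_arcsD1 in_arcsD2 by (auto simp: awalk_Cons_iff awalk_Nil_iff)
    then have "awalk u (p @ [(x, y)]) y" using p by (blast intro: awalk_appendI)
    then show ?case using p step.hyps(2) by (intro exI[of _ "p @ [(x, y)]"]) auto
  qed
  then obtain q where "awalk u q w" "set q \<subseteq> ?E" by blast
  define p where "p = awalk_to_apath q"
  have p: "apath u p w" "set p \<subseteq> ?E"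
    using apath_awalk_to_apath[OF \<open>awalk u q w\<close>] awalk_to_apath_subset[OF \<open>awalk u q w\<close>]
      \<open>set q \<subseteq> ?E\<close> unfolding p_def by blast+
  then have walk: "awalk u p w" and dist: "distinct (pawalk_verts u p)"
    by (auto simp: apath_def)
  have avoid: "v \<notin> set (pawalk_verts u p)"
    using p(2) uw(2)
    by (induction p arbitrary: u) auto
  let ?c = "(v, u) # p @ [(w, v)]"
  have "awalk w [(w, v)] v" using uw by (simp add: awalk_Cons_iff awalk_Nil_iff)
  with walk have tail: "awalk u (p @ [(w, v)]) v" by (blast intro: awalk_appendI)
  then have "awalk v ?c v" using arcs(1) uw by (auto simp: awalk_def)
  moreover have "pawalk_verts u (p @ [(w, v)]) = pawalk_verts u p @ [v]"
    using awalk_verts_append[OF tail] walk by auto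
  ultimately have "cycle ?c" using dist avoid unfolding cycle_def by (intro exI[of _ v]) auto
  moreover have "p \<noteq> []" using walk \<open>u \<noteq> w\<close> by (auto simp: awalk_Nil_iff)
  then have "3 \<le> length ?c" by (cases p) auto
  ultimately show False using T by (auto simp: undirected_tree_def)
qed

text \<open>
  Measure depth by the distance from the root. A shortest path from the root to a vertex other than
  \<open>v\<close> that is no deeper than \<open>v\<close> cannot pass through \<open>v\<close>. So two neighbors of \<open>v\<close> that are no deeper
  than \<open>v\<close> are joined outside \<open>v\<close> and coincide: the parent is the only such neighbor.
\<close>

lemma tree_rooted_graph:
  assumes T: "undirected_tree T"
  obtains root parent depth where "rooted_graph T root parent depth"
proof -
  interpret pair_graph T using T by (simp add: undirected_tree_def)
  have conn: "strongly_connected (with_proj T)"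
    using T pair_sym_arcs by (auto simp: undirected_tree_def symmetric_connected_imp_strongly_connected)
  then obtain r where r: "r \<in> pverts T" by (auto simp: strongly_connected_def)
  have "(r, v) \<in> (parcs T)\<^sup>*" if "v \<in> pverts T" for v
  proof -
    have "r \<rightarrow>\<^sup>*\<^bsub>with_proj T\<^esub> v" using conn r that by (auto simp: strongly_connected_def)
    then show ?thesis using reachable_rtranclI[of "with_proj T" r v] by simp
  qed
  then have ex: "\<exists>n. (r, v) \<in> parcs T ^^ n" if "v \<in> pverts T" for v
    using that rtrancl_imp_relpow by blast
  define depth where "depth v = (LEAST n. (r, v) \<in> parcs T ^^ n)" for v
  have closer: "\<exists>w. (v, w) \<in> parcs T \<and> depth w < depth v" if v: "v \<in> pverts T" "v \<noteq> r" for v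
  proof -
    have n: "(r, v) \<in> parcs T ^^ depth v"
      unfolding depth_def by (rule LeastI_ex) (rule ex[OF v(1)])
    with v obtain m where m: "depth v = Suc m" by (cases "depth v") auto
    with n obtain w where w: "(r, w) \<in> parcs T ^^ m" "(w, v) \<in> parcs T" by auto
    have "depth w \<le> m" unfolding depth_def by (rule Least_le) (rule w(1))
    with w m show ?thesis using arcs_symmetric by (intro exI[of _ w]) auto
  qed
  have depth_root: "depth r = 0" by (simp add: depth_def)
  have root_only: "v = r" if "v \<in> pverts T" "depth v = 0" for v
    using closer[of v] that by auto
  have avoid: "u \<in> pverts T \<longrightarrow> u \<noteq> v \<longrightarrow> depth u \<le> depth v
      \<longrightarrow> (r, u) \<in> (parcs T \<inter> (- {v}) \<times> (- {v}))\<^sup>*" for u v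
  proof (induction u rule: measure_induct_rule[of depth])
    case (less u)
    show ?case
    proof (intro impI)
      assume u: "u \<in> pverts T" "u \<noteq> v" "depth u \<le> depth v"
      show "(r, u) \<in> (parcs T \<inter> (- {v}) \<times> (- {v}))\<^sup>*"
      proof (cases "u = r")
        case False
        then obtain w where w: "(u, w) \<in> parcs T" "depth w < depth u" using closer u by blast
        then have "w \<noteq> v" "w \<in> pverts T" using u in_arcsD2 by auto
        with less w u have "(r, w) \<in> (parcs T \<inter> (- {v}) \<times> (- {v}))\<^sup>*" by simp
        moreover have "(w, u) \<in> parcs T \<inter> (- {v}) \<times> (- {v})"
          using w u \<open>w \<noteq> v\<close> arcs_symmetric by auto
        ultimately show ?thesis by (rule rtrancl_into_rtrancl)
      qed simp
    qed
  qed
  have unique: "u = w"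
    if "(v, u) \<in> parcs T" "(v, w) \<in> parcs T" "depth u \<le> depth v" "depth w \<le> depth v" for u v w
  proof -
    let ?E = "parcs T \<inter> (- {v}) \<times> (- {v})"
    have "u \<in> pverts T" "w \<in> pverts T" "u \<noteq> v" "w \<noteq> v"
      using that in_arcsD2 no_loops' by blast+
    then have "(r, u) \<in> ?E\<^sup>*" "(r, w) \<in> ?E\<^sup>*" using avoid that by auto
    moreover have "sym (?E\<^sup>*)" by (rule sym_rtrancl) (auto intro: symI arcs_symmetric)
    ultimately have "(u, w) \<in> ?E\<^sup>*" by (meson rtrancl_trans symD)
    with that show ?thesis using tree_neighbors_separated[OF T] by blast
  qed
  define parent where "parent v = (SOME w. (v, w) \<in> parcs T \<and> depth w < depth v)" for v
  have parent: "(v, parent v) \<in> parcs T \<and> depth (parent v) < depth v"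
    if "v \<in> pverts T" "v \<noteq> r" for v
    unfolding parent_def by (rule someI_ex) (rule closer[OF that])
  have lower: "u \<noteq> r \<and> v = parent u" if "(u, v) \<in> parcs T" "depth v \<le> depth u" for u v
  proof -
    have uv: "u \<in> pverts T" "v \<in> pverts T" "u \<noteq> v" using that in_arcsD1 in_arcsD2 no_loops' by blast+
    then have "u \<noteq> r" using root_only[of v] that depth_root by auto
    then show ?thesis using parent[of u] uv that unique[of u v "parent u"] by auto
  qed
  have "rooted_graph T r parent depth"
  proof
    show "(u \<noteq> r \<and> v = parent u) \<or> (v \<noteq> r \<and> u = parent v)" if "(u, v) \<in> parcs T" for u v
      using lower[of u v] lower[of v u] that arcs_symmetric[of u v] by (meson linear)
  qed (use r parent in auto)
  then show ?thesis by (rule that)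
qed

section \<open>Degree proportional thresholds in trees\<close>

theorem theorem2:
  fixes \<rho> :: real and T :: "'a pair_pre_digraph"
  assumes "0 < \<rho>" and "\<rho> \<le> 1"
    and "undirected_tree T"
    and "real (order T) \<ge> 1 / \<rho>"
  shows "real (min_dynamic_monopoly T (degree_proportional \<rho> T)) \<le> \<rho> * real (order T)"
proof -
  obtain root parent depth where "rooted_graph T root parent depth"
    using tree_rooted_graph[OF assms(3)] .
  then interpret rooted_graph T root parent depth .
  let ?\<phi> = "degree_proportional \<rho> T"
  have "min_dynamic_monopoly T ?\<phi> \<le> card (seeds ?\<phi>)"
    unfolding min_dynamic_monopoly_def
    by (rule Least_le) (use dynamic_monopoly_seeds in blast)
  moreover have "real (card (seeds ?\<phi>)) \<le> \<rho> * real (order T)"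
  proof (rule card_seeds_le[OF assms(1,2)])
    show "real k < \<rho> * real (card (neighbors T v))" if "k < ?\<phi> v" for v k
    proof -
      have "int k < \<lceil>\<rho> * real (card (neighbors T v))\<rceil>"
        using that by (simp add: degree_proportional_def degree_eq_card_neighbors)
      then show ?thesis by (simp add: less_ceiling_iff)
    qed
    show "1 \<le> \<rho> * real (order T)"
      using assms(1,4) by (simp add: field_simps)
  qed
  ultimately show ?thesis by linarith
qed

end
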